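(* Let $(X,\mathsf{d},\mathfrak{m})$ be a complete metric measure space with $\mathfrak{m}(X)<\infty$. Then for any positive integer $k$, $$p\,\big(\lambda_{k,p}(X)\big)^{1/p}\le q\,\big(\lambda_{k,q}(X)\big)^{1/q}\qquad\text{for every }1\le p<q<\infty.$$
   Context: A metric measure space is a complete separable metric space $(X,\mathsf{d})$ with a finite Borel measure $\mathfrak{m}$. $\mathsf{Lip}_{bs}(X)$ is the space of real-valued Lipschitz functions on $X$ with bounded support. The slope of $f$ at $x$ is $\mathrm{lip}(f)(x)=\limsup_{y\to x}\frac{|f(y)-f(x)|}{\mathsf{d}(y,x)}$ ($0$ if $x$ is isolated). For $k\ge1$, $1\le p<\infty$, $$\lambda_{k,p}(X)=\inf\Big\{\sup_{f\in S}\frac{\int_X\mathrm{lip}(f)^p\,d\mathfrak{m}}{\int_X|f|^p\,d\mathfrak{m}}:\ S\subset\mathsf{Lip}_{bs}(X)\setminus\{0\}\text{ centrally symmetric},\ \mathrm{genus}(S)\ge k\Big\},$$ where nonzero means not $\mathfrak{m}$-a.e. zero, and $\mathrm{genus}(S)$ is the Krasnoselskii genus: the least $m$ such that there is a continuous map $\zeta:S\to\mathbb{S}^{m-1}$ with $\zeta(f)=-\zeta(-f)$ (and $+\infty$ if none exists), continuity being with respect to the supremum norm. *)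

theory Defs
  imports "HOL-Analysis.Analysis"
begin

text \<open>The metric space is a whole type of class \<open>polish_space\<close> (complete, second countable, hence
  separable).\<close>

definition ennpowr :: "ennreal \<Rightarrow> real \<Rightarrow> ennreal" where
  "ennpowr x r = (if x = \<infinity> then \<infinity> else ennreal (enn2real x powr r))"
  \<comment> \<open>only meant for exponents \<open>r > 0\<close>, where \<open>0 powr r = 0\<close> and \<open>\<infinity> powr r = \<infinity>\<close>\<close>

definition slope :: "('a::metric_space \<Rightarrow> real) \<Rightarrow> 'a \<Rightarrow> ennreal" where
  "slope f x = (if x isolated_in UNIV then 0
                else Limsup (at x) (\<lambda>y. ennreal (\<bar>f y - f x\<bar> / dist y x)))"

text \<open>Lipschitz functions with bounded support are bounded and continuous, so they are represented
  as elements of the library type of bounded continuous functions, whose norm, metric and topology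
  are those of the supremum norm. The lemma shows that no function is lost.\<close>

definition Lip_bs :: "('a::metric_space \<Rightarrow>\<^sub>C real) set" where
  "Lip_bs = {f :: 'a \<Rightarrow>\<^sub>C real.
     (\<exists>L. L-lipschitz_on UNIV f) \<and> bounded (closure {x. f x \<noteq> 0})}"

lemma lipschitz_bounded_support_bcontfun:
  fixes f :: "'a::metric_space \<Rightarrow> real"
  assumes L: "L-lipschitz_on UNIV f" and b: "bounded (closure {x. f x \<noteq> 0})"
  shows "f \<in> bcontfun"
proof -
  obtain x0 e where e: "dist x0 x \<le> e" if "f x \<noteq> 0" for x
    using bounded_subset[OF b closure_subset] unfolding bounded_def by auto
  have "dist (f x0) (f x) \<le> L * e" if "f x \<noteq> 0" for x
    using lipschitz_onD[OF L, of x0 x] lipschitz_on_nonneg[OF L] e[OF that]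
    by (meson UNIV_I mult_left_mono order_trans)
  then have "bounded (f ` {x. f x \<noteq> 0})"
    unfolding bounded_def by auto
  moreover have "range f \<subseteq> insert 0 (f ` {x. f x \<noteq> 0})"
    by auto
  ultimately have "bounded (range f)"
    by (meson bounded_insert bounded_subset)
  then show ?thesis
    using L by (simp add: bcontfun_def lipschitz_on_continuous_on)
qed

definition centrally_symmetric :: "'a::real_normed_vector set \<Rightarrow> bool" where
  "centrally_symmetric S \<longleftrightarrow> (\<forall>f\<in>S. - f \<in> S)"

text \<open>Existence of a continuous odd map from \<open>S\<close> to the unit sphere of the \<open>m\<close>-dimensional
  Euclidean space, which is \<open>nsphere (m - 1)\<close> for \<open>m \<ge> 1\<close> and empty for \<open>m = 0\<close>. Thus the empty
  set, and only the empty set, has genus \<open>0\<close>.\<close>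

definition odd_sphere_map :: "'a::real_normed_vector set \<Rightarrow> nat \<Rightarrow> bool" where
  "odd_sphere_map S m \<longleftrightarrow>
     (if m = 0 then S = {}
      else \<exists>\<zeta>. continuous_map (top_of_set S) (nsphere (m - 1)) \<zeta> \<and>
               (\<forall>f\<in>S. \<zeta> f = (\<lambda>i. - \<zeta> (- f) i)))"

definition genus :: "'a::real_normed_vector set \<Rightarrow> enat" where
  "genus S = Inf {enat m | m. odd_sphere_map S m}"

definition rayleigh :: "'a::metric_space measure \<Rightarrow> real \<Rightarrow> ('a \<Rightarrow> real) \<Rightarrow> ennreal" where
  "rayleigh M p f = (\<integral>\<^sup>+x. ennpowr (slope f x) p \<partial>M) / (\<integral>\<^sup>+x. ennreal (\<bar>f x\<bar> powr p) \<partial>M)"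

text \<open>The infimum over the empty family is \<open>\<infinity>\<close>, as usual.\<close>

definition eigenval :: "'a::metric_space measure \<Rightarrow> nat \<Rightarrow> real \<Rightarrow> ennreal" where
  "eigenval M k p =
     (INF S \<in> {S. S \<subseteq> {f \<in> Lip_bs. \<not> (AE x in M. f x = 0)} \<and>
                  centrally_symmetric S \<and> enat k \<le> genus S}.
        SUP f\<in>S. rayleigh M p (apply_bcontfun f))"

end

theory Submission
  imports Defs
begin

text \<open>The signed power \<open>f \<mapsto> sgn f \<cdot> \<bar>f\<bar> powr r\<close> with \<open>r = q / p\<close> is odd and continuous for the
  supremum norm, so it carries competitors for \<open>q\<close> to competitors for \<open>p\<close> without decreasing
  the genus. The chain rule bounds the slope of the image by \<open>r \<bar>f\<bar> powr (r - 1)\<close> times the slope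
  of \<open>f\<close>, and Hoelder's inequality then bounds its \<open>p\<close>-Rayleigh quotient by
  \<open>(q / p) powr p\<close> times the power \<open>p / q\<close> of the \<open>q\<close>-Rayleigh quotient of \<open>f\<close>.\<close>

section \<open>Powers of extended nonnegative reals\<close>

lemma ennpowr_ennreal: "x \<ge> 0 \<Longrightarrow> ennpowr (ennreal x) a = ennreal (x powr a)"
  by (simp add: ennpowr_def)

lemma ennpowr_top [simp]: "ennpowr top a = top"
  by (simp add: ennpowr_def)

lemma ennpowr_mono: "x \<le> y \<Longrightarrow> a \<ge> 0 \<Longrightarrow> ennpowr x a \<le> ennpowr y a"
  by (cases x; cases y) (auto simp: ennpowr_ennreal top_unique intro!: ennreal_leI powr_mono2)

lemma ennpowr_ennpowr: "ennpowr (ennpowr x a) b = ennpowr x (a * b)"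
  by (cases x) (simp_all add: ennpowr_ennreal powr_powr)

lemma ennpowr_one [simp]: "ennpowr x 1 = x"
  by (cases x) (simp_all add: ennpowr_ennreal)

lemma ennpowr_cmult:
  assumes "c > 0"
  shows "ennpowr (ennreal c * x) a = ennreal (c powr a) * ennpowr x a"
proof (cases x)
  case (real y)
  then show ?thesis
    using assms by (simp add: ennpowr_ennreal powr_mult flip: ennreal_mult)
qed (use assms in \<open>simp add: ennreal_mult_top\<close>)

section \<open>Hoelder's inequality\<close>

text \<open>For positive arguments this is Young's inequality in weighted form; a zero argument
  makes the left side vanish.\<close>

lemma powr_mult_powr_le:
  fixes a b \<alpha> \<beta> :: real
  assumes "0 < \<alpha>" "0 < \<beta>" "\<alpha> + \<beta> = 1" "a \<ge> 0" "b \<ge> 0"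
  shows "a powr \<alpha> * b powr \<beta> \<le> \<alpha> * a + \<beta> * b"
  using Youngs_inequality_0[of \<alpha> \<beta> a b] assms
  by (cases "a = 0 \<or> b = 0") auto

text \<open>Hoelder's inequality with conjugate exponents \<open>1 / \<alpha>\<close> and
  \<open>1 / \<beta>\<close>, for the functions \<open>F powr \<alpha>\<close> and
  \<open>G powr \<beta>\<close>. Normalise \<open>F\<close> and \<open>G\<close> by their integrals
  and integrate the weighted Young inequality pointwise.\<close>

lemma integral_powr_mult_powr_le:
  fixes F G :: "'a \<Rightarrow> real"
  assumes ab: "0 < \<alpha>" "0 < \<beta>" "\<alpha> + \<beta> = 1"
    and F: "integrable M F" "\<And>x. F x \<ge> 0" and G: "integrable M G" "\<And>x. G x \<ge> 0"
  shows "integrable M (\<lambda>x. F x powr \<alpha> * G x powr \<beta>)"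
    and "(\<integral>x. F x powr \<alpha> * G x powr \<beta> \<partial>M) \<le> (\<integral>x. F x \<partial>M) powr \<alpha> * (\<integral>x. G x \<partial>M) powr \<beta>"
proof -
  have m: "(\<lambda>x. F x powr \<alpha> * G x powr \<beta>) \<in> borel_measurable M"
    using F(1) G(1) by measurable
  show int: "integrable M (\<lambda>x. F x powr \<alpha> * G x powr \<beta>)"
  proof (rule Bochner_Integration.integrable_bound[OF _ m])
    show "integrable M (\<lambda>x. \<alpha> * F x + \<beta> * G x)"
      using F(1) G(1) by simp
    show "AE x in M. norm (F x powr \<alpha> * G x powr \<beta>) \<le> norm (\<alpha> * F x + \<beta> * G x)"
      using powr_mult_powr_le[OF ab F(2) G(2)] ab F(2) G(2) by (simp add: abs_mult)
  qed
  define a b where "a = (\<integral>x. F x \<partial>M)" and "b = (\<integral>x. G x \<partial>M)"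
  have ge: "a \<ge> 0" "b \<ge> 0"
    using F(2) G(2) by (simp_all add: a_def b_def)
  show "(\<integral>x. F x powr \<alpha> * G x powr \<beta> \<partial>M) \<le> (\<integral>x. F x \<partial>M) powr \<alpha> * (\<integral>x. G x \<partial>M) powr \<beta>"
  proof (cases "a = 0 \<or> b = 0")
    \<comment> \<open>Normalising is impossible here, but \<open>F\<close> or \<open>G\<close>, and
      hence the product, is zero almost everywhere.\<close>
    case True
    then have "AE x in M. F x powr \<alpha> * G x powr \<beta> = 0"
      using integral_nonneg_eq_0_iff_AE[OF F(1)] integral_nonneg_eq_0_iff_AE[OF G(1)] F(2) G(2)
      unfolding a_def b_def by auto
    then have "(\<integral>x. F x powr \<alpha> * G x powr \<beta> \<partial>M) = 0"
      by (rule integral_eq_zero_AE)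
    then show ?thesis
      by simp
  next
    case False
    then have pos: "a > 0" "b > 0"
      using ge by auto
    let ?c = "a powr \<alpha> * b powr \<beta>"
    \<comment> \<open>Both normalised functions have integral one, so the right side integrates to
      \<open>?c * (\<alpha> + \<beta>)\<close>, which is \<open>?c\<close>.\<close>
    have "(\<integral>x. F x powr \<alpha> * G x powr \<beta> \<partial>M) \<le> (\<integral>x. ?c * (\<alpha> * (F x / a) + \<beta> * (G x / b)) \<partial>M)"
    proof (rule integral_mono[OF int])
      show "integrable M (\<lambda>x. ?c * (\<alpha> * (F x / a) + \<beta> * (G x / b)))"
        using F(1) G(1) by simp
      show "F x powr \<alpha> * G x powr \<beta> \<le> ?c * (\<alpha> * (F x / a) + \<beta> * (G x / b))" for x
      proof -
        have "F x powr \<alpha> * G x powr \<beta> = ?c * ((F x / a) powr \<alpha> * (G x / b) powr \<beta>)"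
          using pos F(2) G(2) by (simp add: powr_divide)
        also have "\<dots> \<le> ?c * (\<alpha> * (F x / a) + \<beta> * (G x / b))"
          using pos F(2) G(2) by (intro mult_left_mono powr_mult_powr_le[OF ab]) auto
        finally show ?thesis .
      qed
    qed
    also have "\<dots> = ?c * (\<alpha> * (a / a) + \<beta> * (b / b))"
      using F(1) G(1) by (simp add: a_def b_def)
    also have "\<dots> = ?c"
      using pos ab by simp
    finally show ?thesis
      by (simp add: a_def b_def)
  qed
qed

section \<open>Slopes\<close>

text \<open>At an isolated point the filter \<open>at x\<close> is \<open>bot\<close>, and
  \<open>Limsup\<close> over it is the least element, which is \<open>0\<close>.\<close>

lemma slope_eq_Limsup: "slope f x = Limsup (at x) (\<lambda>y. ennreal (\<bar>f y - f x\<bar> / dist y x))"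
proof (cases "x isolated_in UNIV")
  case True
  then have "at x = bot"
    by (simp add: isolated_in_islimpt_iff trivial_limit_within)
  then show ?thesis
    using True by (simp add: slope_def bot_ennreal)
qed (simp add: slope_def)

lemma slope_le:
  assumes "L-lipschitz_on UNIV f"
  shows "slope f x \<le> ennreal L"
  unfolding slope_eq_Limsup
proof (rule Limsup_bounded)
  have "\<bar>f y - f x\<bar> / dist y x \<le> L" if "y \<noteq> x" for y
    using lipschitz_onD[OF assms, of y x] that by (simp add: dist_real_def divide_le_eq)
  then show "\<forall>\<^sub>F y in at x. ennreal (\<bar>f y - f x\<bar> / dist y x) \<le> ennreal L"
    by (auto simp: eventually_at_filter intro!: always_eventually ennreal_leI)
qed

text \<open>For a fixed radius the supremum \<open>h e\<close> of difference quotients is lower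
  semicontinuous, and the slope is the infimum of countably many of these.\<close>

lemma borel_measurable_slope:
  fixes f :: "'a::metric_space \<Rightarrow> real"
  assumes f: "continuous_on UNIV f"
  shows "slope f \<in> borel_measurable borel"
proof -
  define Q where "Q x y = ennreal (\<bar>f y - f x\<bar> / dist y x)" for x y
  define h where "h e x = (SUP y\<in>ball x e - {x}. Q x y)" for e x
  have h: "h e \<in> borel_measurable borel" for e
  proof (rule borel_measurableI_greater)
    fix a
    have "continuous_on (ball y e - {y}) (\<lambda>x. Q x y)" for y
      unfolding Q_def
      by (intro continuous_on_ennreal continuous_on_divide continuous_on_rabs continuous_on_diff
          continuous_on_const continuous_on_dist continuous_on_id continuous_on_subset[OF f]) auto
    then have "open ((\<lambda>x. Q x y) -` {a<..} \<inter> (ball y e - {y}))" for y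
      by (subst (asm) continuous_on_open_vimage) (auto intro!: open_Diff)
    then have "open (\<Union>y. (\<lambda>x. Q x y) -` {a<..} \<inter> (ball y e - {y}))"
      by blast
    \<comment> \<open>By symmetry of the distance, \<open>y\<close> lies in the punctured ball about
      \<open>x\<close> exactly when \<open>x\<close> lies in the one about \<open>y\<close>.\<close>
    also have "(\<Union>y. (\<lambda>x. Q x y) -` {a<..} \<inter> (ball y e - {y})) = {x. a < h e x}"
      by (auto simp: h_def less_SUP_iff dist_commute)
    finally show "{x \<in> space borel. a < h e x} \<in> sets borel"
      by simp
  qed
  have "slope f x = (INF n. h (inverse (Suc n)) x)" for x
  proof -
    have "slope f x = (INF e\<in>{0<..}. h e x)"
      by (simp add: slope_eq_Limsup Limsup_at h_def Q_def)
    also have "\<dots> = (INF n. h (inverse (Suc n)) x)"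
    proof (rule antisym)
      show "(INF e\<in>{0<..}. h e x) \<le> (INF n. h (inverse (Suc n)) x)"
        by (rule INF_greatest, rule INF_lower) auto
      \<comment> \<open>\<open>h e x\<close> grows with \<open>e\<close>, so a sequence of radii
        tending to zero already reaches the infimum.\<close>
      show "(INF n. h (inverse (Suc n)) x) \<le> (INF e\<in>{0<..}. h e x)"
      proof (rule INF_mono)
        fix e :: real assume "e \<in> {0<..}"
        then obtain n where "inverse (Suc n) < e"
          using reals_Archimedean by auto
        then show "\<exists>n\<in>UNIV. h (inverse (Suc n)) x \<le> h e x"
          by (intro bexI[of _ n]) (auto simp: h_def intro!: SUP_subset_mono)
      qed
    qed
    finally show ?thesis .
  qed
  then have "slope f = (\<lambda>x. INF n. h (inverse (Suc n)) x)"
    by auto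
  then show ?thesis
    using h by simp
qed

section \<open>Signed powers\<close>

definition spowr :: "real \<Rightarrow> real \<Rightarrow> real" where
  "spowr r t = sgn t * \<bar>t\<bar> powr r"

lemma spowr_minus [simp]: "spowr r (- t) = - spowr r t"
  by (simp add: spowr_def)

lemma spowr_eq_0_iff [simp]: "spowr r t = 0 \<longleftrightarrow> t = 0"
  by (simp add: spowr_def sgn_0_0)

lemma abs_spowr: "\<bar>spowr r t\<bar> = \<bar>t\<bar> powr r"
  by (simp add: spowr_def abs_mult abs_sgn_eq)

text \<open>Mean value theorem: the derivative \<open>r * z powr (r - 1)\<close> is largest at the
  right endpoint.\<close>

lemma powr_diff_le:
  fixes a b r :: real
  assumes "1 \<le> r" "0 \<le> b" "b \<le> a"
  shows "a powr r - b powr r \<le> r * a powr (r - 1) * (a - b)"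
\<comment> \<open>The derivative rule is applied only at positive points, and the mean value theorem
  wants a nondegenerate interval.\<close>
proof (cases "b = 0 \<or> b = a")
  case True
  moreover have "a powr r \<le> r * a powr r"
    using assms mult_right_mono[of 1 r "a powr r"] by simp
  moreover have "a powr (r - 1) * a = a powr r" if "a > 0"
    using that by (simp add: powr_diff)
  ultimately show ?thesis
    using assms by (cases "a = 0") (auto simp: mult.assoc)
next
  case False
  then have "b < a" "0 < b"
    using assms by auto
  have "\<exists>z>b. z < a \<and> a powr r - b powr r = (a - b) * (r * z powr (r - 1))"
  proof (rule MVT2[OF \<open>b < a\<close>])
    fix z assume "b \<le> z" "z \<le> a"
    with \<open>0 < b\<close> show "((\<lambda>t. t powr r) has_real_derivative r * z powr (r - 1)) (at z)"
      by (intro has_real_derivative_powr) auto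
  qed
  then obtain z where z: "b < z" "z < a" "a powr r - b powr r = (a - b) * (r * z powr (r - 1))"
    by blast
  have "z powr (r - 1) \<le> a powr (r - 1)"
    using z \<open>0 < b\<close> assms by (intro powr_mono2) auto
  then have "(a - b) * (r * z powr (r - 1)) \<le> (a - b) * (r * a powr (r - 1))"
    using assms by (intro mult_left_mono) auto
  then show ?thesis
    using z by (simp add: mult_ac)
qed

text \<open>Counterpart of \<open>powr_diff_le\<close> for values of opposite sign, whose signed
  powers differ by a sum of powers.\<close>

lemma powr_add_le:
  fixes a b r :: real
  assumes "1 \<le> r" "0 \<le> b" "b \<le> a"
  shows "a powr r + b powr r \<le> r * a powr (r - 1) * (a + b)"
proof -
  have eq: "t powr r = t powr (r - 1) * t" if "t \<ge> 0" for t :: real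
    using that by (cases "t = 0") (simp_all add: powr_diff)
  have "a powr r + b powr r \<le> a powr (r - 1) * a + a powr (r - 1) * b"
    using assms by (simp add: eq) (intro mult_right_mono powr_mono2; simp)
  also have "\<dots> = 1 * (a powr (r - 1) * (a + b))"
    by (simp add: algebra_simps)
  also have "\<dots> \<le> r * (a powr (r - 1) * (a + b))"
    using assms by (intro mult_right_mono) auto
  finally show ?thesis
    by (simp add: mult.assoc)
qed

lemma spowr_diff_le:
  assumes "1 \<le> r"
  shows "\<bar>spowr r a - spowr r b\<bar> \<le> r * (max \<bar>a\<bar> \<bar>b\<bar>) powr (r - 1) * \<bar>a - b\<bar>"
proof -
  have *: "\<bar>spowr r a - spowr r b\<bar> \<le> r * \<bar>a\<bar> powr (r - 1) * \<bar>a - b\<bar>" if ab: "\<bar>b\<bar> \<le> \<bar>a\<bar>" for a b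
  proof (cases "a * b \<ge> 0")
    case True
    then have "\<bar>spowr r a - spowr r b\<bar> = \<bar>a\<bar> powr r - \<bar>b\<bar> powr r" and "\<bar>a - b\<bar> = \<bar>a\<bar> - \<bar>b\<bar>"
      using ab powr_mono2[of r "\<bar>b\<bar>" "\<bar>a\<bar>"] assms
      by (auto simp: spowr_def sgn_if abs_if zero_le_mult_iff split: if_splits)
    then show ?thesis
      using powr_diff_le[of r "\<bar>b\<bar>" "\<bar>a\<bar>"] ab assms by simp
  next
    case False
    then consider "a > 0" "b < 0" | "a < 0" "b > 0"
      by (auto simp: zero_le_mult_iff)
    then have "\<bar>spowr r a - spowr r b\<bar> = \<bar>a\<bar> powr r + \<bar>b\<bar> powr r \<and> \<bar>a - b\<bar> = \<bar>a\<bar> + \<bar>b\<bar>"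
      by cases (simp_all add: spowr_def, smt (verit) powr_ge_zero)
    then show ?thesis
      using powr_add_le[of r "\<bar>b\<bar>" "\<bar>a\<bar>"] ab assms by simp
  qed
  show ?thesis
    using *[of b a] *[of a b] by (cases "\<bar>b\<bar> \<le> \<bar>a\<bar>") (simp_all add: abs_minus_commute max_def)
qed

text \<open>A uniform Lipschitz constant on \<open>{- B..B}\<close>. It serves the slope estimate,
  the Lipschitz property of the image and the continuity in the supremum norm.\<close>

lemma spowr_diff_le_bound:
  assumes "1 \<le> r" "\<bar>a\<bar> \<le> B" "\<bar>b\<bar> \<le> B"
  shows "\<bar>spowr r a - spowr r b\<bar> \<le> r * B powr (r - 1) * \<bar>a - b\<bar>"
proof -
  have "(max \<bar>a\<bar> \<bar>b\<bar>) powr (r - 1) \<le> B powr (r - 1)"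
    using assms by (intro powr_mono2) auto
  then have "r * (max \<bar>a\<bar> \<bar>b\<bar>) powr (r - 1) * \<bar>a - b\<bar> \<le> r * B powr (r - 1) * \<bar>a - b\<bar>"
    using assms by (intro mult_right_mono mult_left_mono) auto
  then show ?thesis
    using spowr_diff_le[OF assms(1), of a b] by linarith
qed

text \<open>Near \<open>x\<close> the values of \<open>f\<close> are bounded by
  \<open>\<bar>f x\<bar> + e\<close>, which gives the Lipschitz constant of the signed power there;
  then \<open>e\<close> tends to zero. For \<open>r = 1\<close> the bound would fail at zeros of
  \<open>f\<close>, since \<open>0 powr 0 = 0\<close>.\<close>

lemma slope_spowr_le:
  fixes f :: "'a::metric_space \<Rightarrow> real"
  assumes r: "1 < r" and L: "L-lipschitz_on UNIV f"
  shows "slope (\<lambda>x. spowr r (f x)) x \<le> ennreal (r * \<bar>f x\<bar> powr (r - 1)) * slope f x"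
proof (cases "at x = bot")
  case True
  then show ?thesis
    by (simp add: slope_eq_Limsup bot_ennreal)
next
  case nontriv: False
  let ?s = "enn2real (slope f x)"
  have s: "slope f x = ennreal ?s"
    using slope_le[OF L, of x] by (simp add: less_top order_le_less_trans)
  have le: "slope (\<lambda>x. spowr r (f x)) x \<le> ennreal (r * (\<bar>f x\<bar> + e) powr (r - 1) * ?s)"
    if e: "e > 0" for e
  proof -
    let ?c = "r * (\<bar>f x\<bar> + e) powr (r - 1)"
    have c: "?c \<ge> 0"
      using r by simp
    have "(f \<longlongrightarrow> f x) (at x)"
      using lipschitz_on_continuous_on[OF L] by (simp add: continuous_on_def)
    then have "\<forall>\<^sub>F y in at x. dist (f y) (f x) < e"
      using e by (rule tendstoD)
    then have "\<forall>\<^sub>F y in at x. ennreal (\<bar>spowr r (f y) - spowr r (f x)\<bar> / dist y x)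
        \<le> ennreal ?c * ennreal (\<bar>f y - f x\<bar> / dist y x)"
    proof (eventually_elim)
      case (elim y)
      then have "\<bar>spowr r (f y) - spowr r (f x)\<bar> \<le> ?c * \<bar>f y - f x\<bar>"
        using r e by (intro spowr_diff_le_bound) (auto simp: dist_real_def)
      then have "\<bar>spowr r (f y) - spowr r (f x)\<bar> / dist y x \<le> ?c * \<bar>f y - f x\<bar> / dist y x"
        by (rule divide_right_mono) simp
      then show ?case
        using c by (simp add: ennreal_leI flip: ennreal_mult)
    qed
    then have "slope (\<lambda>x. spowr r (f x)) x
        \<le> Limsup (at x) (\<lambda>y. ennreal ?c * ennreal (\<bar>f y - f x\<bar> / dist y x))"
      unfolding slope_eq_Limsup by (rule Limsup_mono)
    also have "\<dots> = ennreal ?c * slope f x"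
      unfolding slope_eq_Limsup
    \<comment> \<open>Multiplication by a finite constant is continuous and monotone, so it commutes
      with \<open>Limsup\<close> over a nontrivial filter.\<close>
    proof (rule Limsup_compose_continuous_mono[OF _ _ nontriv])
      show "continuous_on UNIV ((*) (ennreal ?c))"
        by (intro ennreal_continuous_on_cmult continuous_intros) auto
      show "mono ((*) (ennreal ?c))"
        by (auto simp: mono_def intro: mult_left_mono)
    qed
    also have "\<dots> = ennreal (?c * ?s)"
      using c by (subst s) (simp add: ennreal_mult)
    finally show ?thesis .
  qed
  have "((\<lambda>e. ennreal (r * (\<bar>f x\<bar> + e) powr (r - 1) * ?s)) \<longlongrightarrow>
      ennreal (r * (\<bar>f x\<bar> + 0) powr (r - 1) * ?s)) (at_right 0)"
    \<comment> \<open>Where \<open>f x = 0\<close> the base tends to zero, and the power is still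
      continuous because \<open>r - 1 > 0\<close>.\<close>
    using r by (intro tendsto_intros tendsto_powr2) (auto simp: eventually_at_filter)
  then have "slope (\<lambda>x. spowr r (f x)) x \<le> ennreal (r * (\<bar>f x\<bar> + 0) powr (r - 1) * ?s)"
    by (rule tendsto_lowerbound) (auto simp: eventually_at_filter le)
  then show ?thesis
    using r by (subst s) (simp add: ennreal_mult)
qed

section \<open>The signed power as a map on bounded continuous functions\<close>

lemma lipschitz_on_spowr:
  assumes "1 \<le> r"
  shows "(r * B powr (r - 1))-lipschitz_on {- B..B} (spowr r)"
  using assms spowr_diff_le_bound[OF assms]
  by (auto intro!: lipschitz_onI simp: dist_real_def abs_le_iff)

text \<open>\<open>Bcontfun\<close> is meaningful only on bounded continuous functions;
  \<open>apply_bspowr\<close> checks this for \<open>1 \<le> r\<close>.\<close>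

definition bspowr :: "real \<Rightarrow> ('a::topological_space \<Rightarrow>\<^sub>C real) \<Rightarrow> 'a \<Rightarrow>\<^sub>C real" where
  "bspowr r f = Bcontfun (\<lambda>x. spowr r (f x))"

lemma range_bcontfun_subset:
  fixes f :: "'a::topological_space \<Rightarrow>\<^sub>C real"
  shows "range f \<subseteq> {- norm f..norm f}"
  using norm_bounded[of f] by (auto simp: abs_le_iff) (metis minus_le_iff)

lemma apply_bspowr:
  assumes "1 \<le> r"
  shows "bspowr r f x = spowr r (f x)"
proof -
  have "continuous_on UNIV (\<lambda>x. spowr r (f x))"
    by (rule continuous_on_compose2[OF lipschitz_on_continuous_on[OF lipschitz_on_spowr[OF assms]]
          _ range_bcontfun_subset]) simp
  moreover have "norm (spowr r (f x)) \<le> norm f powr r" for x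
    using assms norm_bounded[of f x] by (simp add: abs_spowr powr_mono2)
  ultimately have "(\<lambda>x. spowr r (f x)) \<in> bcontfun"
    by (rule bcontfun_normI)
  then show ?thesis
    by (simp add: bspowr_def Bcontfun_inverse)
qed

lemma bspowr_minus: "1 \<le> r \<Longrightarrow> bspowr r (- f) = - bspowr r f"
  by (simp add: bcontfun_eqI apply_bspowr)

text \<open>The map is Lipschitz on each ball about the origin, which suffices since continuity is
  local.\<close>

lemma continuous_on_bspowr:
  fixes S :: "('a::topological_space \<Rightarrow>\<^sub>C real) set"
  assumes r: "1 \<le> r"
  shows "continuous_on S (bspowr r)"
proof -
  have "isCont (bspowr r) f" for f :: "'a \<Rightarrow>\<^sub>C real"
  proof -
    \<comment> \<open>This radius puts \<open>f\<close> into the open ball about the origin.\<close>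
    let ?B = "norm f + 1"
    have "(r * ?B powr (r - 1))-lipschitz_on (ball (0 :: 'a \<Rightarrow>\<^sub>C real) ?B) (bspowr r)"
    proof (rule lipschitz_onI)
      fix g h :: "'a \<Rightarrow>\<^sub>C real" assume gh: "g \<in> ball 0 ?B" "h \<in> ball 0 ?B"
      show "dist (bspowr r g) (bspowr r h) \<le> r * ?B powr (r - 1) * dist g h"
      proof (rule dist_bound)
        fix x
        have "\<bar>g x\<bar> \<le> ?B" "\<bar>h x\<bar> \<le> ?B"
          using gh norm_bounded[of g x] norm_bounded[of h x] by auto
        then have "dist (bspowr r g x) (bspowr r h x) \<le> r * ?B powr (r - 1) * dist (g x) (h x)"
          using spowr_diff_le_bound[OF r] by (simp add: apply_bspowr r dist_real_def)
        also have "\<dots> \<le> r * ?B powr (r - 1) * dist g h"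
          using r by (intro mult_left_mono dist_bounded) auto
        finally show "dist (bspowr r g x) (bspowr r h x) \<le> r * ?B powr (r - 1) * dist g h" .
      qed
    qed (use r in auto)
    then show ?thesis
      using continuous_on_eq_continuous_at[OF open_ball] lipschitz_on_continuous_on
      by (metis add.commute dist_0_norm less_add_one mem_ball)
  qed
  then show ?thesis
    by (simp add: continuous_at_imp_continuous_on)
qed

text \<open>The values of \<open>f\<close> stay in \<open>{- norm f..norm f}\<close>, where the
  signed power is Lipschitz, and the support is unchanged because \<open>spowr r\<close> vanishes
  only at zero.\<close>

lemma bspowr_in_Lip_bs:
  assumes r: "1 \<le> r" and f: "f \<in> Lip_bs"
  shows "bspowr r f \<in> Lip_bs"
proof -
  obtain L where L: "L-lipschitz_on UNIV f" and b: "bounded (closure {x. f x \<noteq> 0})"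
    using f by (auto simp: Lip_bs_def)
  have "(r * norm f powr (r - 1) * L)-lipschitz_on UNIV (\<lambda>x. spowr r (f x))"
    using L lipschitz_on_subset[OF lipschitz_on_spowr[OF r] range_bcontfun_subset]
    by (rule lipschitz_on_compose2)
  then show ?thesis
    using b r by (auto simp: Lip_bs_def apply_bspowr)
qed

section \<open>Genus\<close>

text \<open>An odd map on the image pulls back along \<open>\<Phi>\<close> to an odd map on
  \<open>S\<close>. For \<open>m = 0\<close> the claim is that only the empty set has empty
  image.\<close>

lemma odd_sphere_map_image:
  assumes cont: "continuous_on S \<Phi>" and odd: "\<And>f. f \<in> S \<Longrightarrow> \<Phi> (- f) = - \<Phi> f"
    and m: "odd_sphere_map (\<Phi> ` S) m"
  shows "odd_sphere_map S m"
proof (cases "m = 0")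
  case False
  then obtain \<zeta> where \<zeta>: "continuous_map (top_of_set (\<Phi> ` S)) (nsphere (m - 1)) \<zeta>"
      "\<forall>f\<in>\<Phi> ` S. \<zeta> f = (\<lambda>i. - \<zeta> (- f) i)"
    using m by (auto simp: odd_sphere_map_def)
  have "continuous_map (top_of_set S) (top_of_set (\<Phi> ` S)) \<Phi>"
    using cont by auto
  then have "continuous_map (top_of_set S) (nsphere (m - 1)) (\<zeta> \<circ> \<Phi>)"
    using \<zeta>(1) by (rule continuous_map_compose)
  moreover have "\<forall>f\<in>S. (\<zeta> \<circ> \<Phi>) f = (\<lambda>i. - (\<zeta> \<circ> \<Phi>) (- f) i)"
    using \<zeta>(2) odd by simp
  ultimately show ?thesis
    using False unfolding odd_sphere_map_def by auto
qed (use m in \<open>simp add: odd_sphere_map_def\<close>)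

text \<open>Every dimension admissible for the image is admissible for \<open>S\<close>, so the
  infimum for \<open>S\<close> runs over a larger set.\<close>

lemma genus_le_genus_image:
  assumes "continuous_on S \<Phi>" and "\<And>f. f \<in> S \<Longrightarrow> \<Phi> (- f) = - \<Phi> f"
  shows "genus S \<le> genus (\<Phi> ` S)"
  unfolding genus_def using odd_sphere_map_image[OF assms] by (intro Inf_superset_mono) blast

section \<open>Comparison of Rayleigh quotients\<close>

text \<open>The two quotients have the same denominator \<open>b\<close>. The chain rule bounds the
  new numerator by \<open>r powr p\<close> times the integral of
  \<open>\<bar>f\<bar> powr (q - p)\<close> times the \<open>p\<close>-th power of the slope, to
  which Hoelder applies.\<close>

lemma rayleigh_spowr_le:
  fixes M :: "'a::metric_space measure" and f :: "'a \<Rightarrow>\<^sub>C real"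
  assumes M: "sets M = sets borel" "finite_measure M"
    and p: "1 \<le> p" "p < q" and f: "f \<in> Lip_bs" "\<not> (AE x in M. f x = 0)"
  shows "rayleigh M p (\<lambda>x. spowr (q / p) (f x))
    \<le> ennreal ((q / p) powr p) * ennpowr (rayleigh M q f) (p / q)"
proof -
  interpret finite_measure M by fact
  define r where "r = q / p"
  \<comment> \<open>The identities in \<open>rp\<close> dictate the choice of \<open>r\<close>: the
    second makes the denominators agree, the first gives the exponent left for Hoelder.\<close>
  have r: "1 < r" and q: "q > 1" and rp: "(r - 1) * p = q - p" "r * p = q"
    using p by (auto simp: r_def field_simps)
  obtain L where L: "L-lipschitz_on UNIV f"
    using f by (auto simp: Lip_bs_def)
  define u where "u x = enn2real (slope f x)" for x
  have u: "slope f x = ennreal (u x)" for x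
    using slope_le[OF L, of x] by (simp add: u_def less_top order_le_less_trans)
  have u0: "u x \<ge> 0" and uL: "u x \<le> L" for x
    using slope_le[OF L, of x] lipschitz_on_nonneg[OF L] by (auto simp: u_def enn2real_leI)
  have "slope f \<in> borel_measurable borel"
    by (rule borel_measurable_slope) simp
  then have um: "u \<in> borel_measurable M"
    unfolding u_def using M(1) by (simp cong: measurable_cong_sets)
  have "(\<lambda>x. f x) \<in> borel_measurable borel"
    by (intro borel_measurable_continuous_onI) simp
  then have fm: "(\<lambda>x. f x) \<in> borel_measurable M"
    using M(1) by (simp cong: measurable_cong_sets)
  define F G where "F x = \<bar>f x\<bar> powr q" and "G x = u x powr q" for x
  \<comment> \<open>Boundedness of \<open>f\<close>, and below of the slope, gives integrability
    because the measure is finite.\<close>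
  have "AE x in M. \<bar>f x\<bar> powr q \<le> norm f powr q"
    using norm_bounded[of f] q by (intro always_eventually allI powr_mono2) auto
  then have F: "integrable M F" "F x \<ge> 0" for x
    unfolding F_def using fm by (auto intro!: integrable_const_bound[where B = "norm f powr q"])
  have "AE x in M. u x powr q \<le> L powr q"
    using u0 uL q by (intro always_eventually allI powr_mono2) auto
  then have G: "integrable M G" "G x \<ge> 0" for x
    unfolding G_def using um by (auto intro!: integrable_const_bound[where B = "L powr q"])
  define a b where "a = (\<integral>x. G x \<partial>M)" and "b = (\<integral>x. F x \<partial>M)"
  have "a \<ge> 0" "b \<ge> 0"
    using F(2) G(2) by (simp_all add: a_def b_def)
  moreover have "F x = 0 \<longleftrightarrow> f x = 0" for x
    by (simp add: F_def)
  then have "b \<noteq> 0"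
    using f(2) integral_nonneg_eq_0_iff_AE[OF F(1)] F(2) by (simp add: b_def)
  ultimately have ab: "a \<ge> 0" "b > 0"
    by auto
  have ray_q: "rayleigh M q f = ennreal (a / b)"
  proof -
    have "(\<integral>\<^sup>+x. ennpowr (slope f x) q \<partial>M) = ennreal a"
      unfolding a_def using G u0 by (simp add: u ennpowr_ennreal nn_integral_eq_integral flip: G_def)
    moreover have "(\<integral>\<^sup>+x. ennreal (\<bar>f x\<bar> powr q) \<partial>M) = ennreal b"
      unfolding b_def using F by (simp add: nn_integral_eq_integral flip: F_def)
    ultimately show ?thesis
      using ab by (simp add: rayleigh_def divide_ennreal)
  qed
  \<comment> \<open>With weights \<open>1 - p / q\<close> and \<open>p / q\<close> the powers of
    \<open>F\<close> and \<open>G\<close> become the two factors in \<open>H_eq\<close>.\<close>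
  define H where "H x = F x powr (1 - p / q) * G x powr (p / q)" for x
  have H: "integrable M H" "(\<integral>x. H x \<partial>M) \<le> b powr (1 - p / q) * a powr (p / q)"
    unfolding H_def a_def b_def using p F G
    by (auto intro!: integral_powr_mult_powr_le)
  have H_eq: "H x = \<bar>f x\<bar> powr (q - p) * u x powr p" for x
    using p q by (simp add: H_def F_def G_def powr_powr right_diff_distrib)
  have H_nonneg: "H x \<ge> 0" for x
    by (simp add: H_eq)
  have "ennpowr (slope (\<lambda>x. spowr r (f x)) x) p \<le> ennreal (r powr p * H x)" for x
  proof -
    have "ennpowr (slope (\<lambda>x. spowr r (f x)) x) p
        \<le> ennpowr (ennreal (r * \<bar>f x\<bar> powr (r - 1) * u x)) p"
      using slope_spowr_le[OF r L, of x] r p u0 by (intro ennpowr_mono) (auto simp: u ennreal_mult)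
    also have "\<dots> = ennreal (r powr p * H x)"
      using r u0 rp by (simp add: ennpowr_ennreal powr_mult powr_powr H_eq mult.assoc)
    finally show ?thesis .
  qed
  then have "(\<integral>\<^sup>+x. ennpowr (slope (\<lambda>x. spowr r (f x)) x) p \<partial>M) \<le> (\<integral>\<^sup>+x. ennreal (r powr p * H x) \<partial>M)"
    by (intro nn_integral_mono) auto
  also have "\<dots> = ennreal (r powr p * (\<integral>x. H x \<partial>M))"
    using H(1) by (subst nn_integral_eq_integral) (auto simp: H_nonneg)
  also have "\<dots> \<le> ennreal (r powr p * (b powr (1 - p / q) * a powr (p / q)))"
    using H(2) by (intro ennreal_leI mult_left_mono) auto
  finally have num: "(\<integral>\<^sup>+x. ennpowr (slope (\<lambda>x. spowr r (f x)) x) p \<partial>M)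
      \<le> ennreal (r powr p * (b powr (1 - p / q) * a powr (p / q)))" .
  have den: "(\<integral>\<^sup>+x. ennreal (\<bar>spowr r (f x)\<bar> powr p) \<partial>M) = ennreal b"
    unfolding b_def using F rp by (simp add: abs_spowr powr_powr nn_integral_eq_integral flip: F_def)
  have "rayleigh M p (\<lambda>x. spowr r (f x))
      \<le> ennreal (r powr p * (b powr (1 - p / q) * a powr (p / q))) / ennreal b"
    unfolding rayleigh_def den by (rule divide_right_mono_ennreal[OF num])
  \<comment> \<open>Dividing \<open>b powr (1 - p / q)\<close> by \<open>b\<close> leaves the power
    \<open>- p / q\<close>.\<close>
  also have "\<dots> = ennreal (r powr p * (a / b) powr (p / q))"
    using ab by (simp add: divide_ennreal powr_diff powr_divide)
  also have "\<dots> = ennreal (r powr p) * ennpowr (rayleigh M q f) (p / q)"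
    using ab by (simp add: ray_q ennpowr_ennreal ennreal_mult)
  finally show ?thesis
    by (simp add: r_def)
qed

text \<open>The image of \<open>S\<close> under \<open>bspowr (q / p)\<close> is a competitor for
  \<open>p\<close>: oddness keeps it symmetric, its elements stay nonzero, and the genus does not
  drop.\<close>

lemma eigenval_le_image:
  fixes M :: "'a::metric_space measure"
  assumes M: "sets M = sets borel" "finite_measure M" and p: "1 \<le> p" "p < q"
    and S: "S \<subseteq> {f \<in> Lip_bs. \<not> (AE x in M. f x = 0)}" "centrally_symmetric S" "enat k \<le> genus S"
  shows "eigenval M k p
    \<le> ennreal ((q / p) powr p) * ennpowr (SUP f\<in>S. rayleigh M q (apply_bcontfun f)) (p / q)"
proof -
  define r where "r = q / p"
  have r: "1 \<le> r"
    using p by (simp add: r_def)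
  let ?T = "bspowr r ` S"
  have "?T \<subseteq> {f \<in> Lip_bs. \<not> (AE x in M. f x = 0)}"
    using S(1) r by (auto simp: bspowr_in_Lip_bs apply_bspowr)
  moreover have "centrally_symmetric ?T"
    using S(2) r by (auto simp: centrally_symmetric_def simp flip: bspowr_minus)
  moreover have "enat k \<le> genus ?T"
    using S(3) genus_le_genus_image[OF continuous_on_bspowr bspowr_minus] r order_trans by blast
  ultimately have "eigenval M k p \<le> (SUP g\<in>?T. rayleigh M p (apply_bcontfun g))"
    unfolding eigenval_def by (intro INF_lower) auto
  also have "\<dots> \<le> ennreal ((q / p) powr p) * ennpowr (SUP f\<in>S. rayleigh M q (apply_bcontfun f)) (p / q)"
  proof (rule SUP_least)
    fix g assume "g \<in> ?T"
    then obtain f where f: "f \<in> S" "g = bspowr r f"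
      by auto
    have "apply_bcontfun g = (\<lambda>x. spowr (q / p) (f x))"
      using f r by (auto simp: apply_bspowr r_def)
    then have "rayleigh M p (apply_bcontfun g)
        \<le> ennreal ((q / p) powr p) * ennpowr (rayleigh M q f) (p / q)"
      using rayleigh_spowr_le[OF M p, of f] f S(1) by auto
    also have "\<dots> \<le> ennreal ((q / p) powr p)
        * ennpowr (SUP f\<in>S. rayleigh M q (apply_bcontfun f)) (p / q)"
      using f p by (intro mult_left_mono ennpowr_mono SUP_upper) auto
    finally show "rayleigh M p (apply_bcontfun g) \<le> \<dots>" .
  qed
  finally show ?thesis .
qed

theorem theorem5p26:
  fixes M :: "'a::polish_space measure" and k :: nat and p q :: real
  assumes "sets M = sets borel" and "finite_measure M"
    and "k \<ge> 1" and "1 \<le> p" and "p < q"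
  shows "ennreal p * ennpowr (eigenval M k p) (1 / p)
       \<le> ennreal q * ennpowr (eigenval M k q) (1 / q)"
proof -
  let ?E = "ennpowr (eigenval M k p) (1 / p)"
  have pq: "0 < p" "0 < q"
    using assms by auto
  \<comment> \<open>The \<open>p\<close>-th root turns the constant into \<open>q / p\<close> and
    the exponent \<open>p / q\<close> into \<open>1 / q\<close>.\<close>
  have root_le: "?E \<le> ennreal (q / p) * ennpowr s (1 / q)"
    if "eigenval M k p \<le> ennreal ((q / p) powr p) * ennpowr s (p / q)" for s
    using ennpowr_mono[OF that, of "1 / p"] pq
    by (simp add: ennpowr_cmult ennpowr_ennpowr powr_powr)
  \<comment> \<open>The estimate is solved for the supremum over \<open>S\<close>, giving a lower
    bound common to all competitors. Thus no power has to be moved past the infimum, and an empty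
    family is covered too.\<close>
  have "ennpowr (ennreal (p / q) * ?E) q \<le> eigenval M k q"
    unfolding eigenval_def[of M k q]
  proof (rule INF_greatest)
    fix S assume S: "S \<in> {S. S \<subseteq> {f \<in> Lip_bs. \<not> (AE x in M. f x = 0)} \<and>
                  centrally_symmetric S \<and> enat k \<le> genus S}"
    let ?s = "SUP f\<in>S. rayleigh M q (apply_bcontfun f)"
    have "?E \<le> ennreal (q / p) * ennpowr ?s (1 / q)"
      using S assms by (intro root_le eigenval_le_image) auto
    then have "ennreal (p / q) * ?E \<le> ennreal (p / q) * (ennreal (q / p) * ennpowr ?s (1 / q))"
      by (rule mult_left_mono) simp
    also have "\<dots> = ennpowr ?s (1 / q)"
      using pq by (simp flip: mult.assoc ennreal_mult)
    finally show "ennpowr (ennreal (p / q) * ?E) q \<le> ?s"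
      using ennpowr_mono[of _ _ q] pq by (fastforce simp: ennpowr_ennpowr)
  qed
  then have "ennreal (p / q) * ?E \<le> ennpowr (eigenval M k q) (1 / q)"
    using ennpowr_mono[of _ _ "1 / q"] pq by (fastforce simp: ennpowr_ennpowr)
  then have "ennreal q * (ennreal (p / q) * ?E) \<le> ennreal q * ennpowr (eigenval M k q) (1 / q)"
    by (rule mult_left_mono) simp
  then show ?thesis
    using pq by (simp flip: mult.assoc ennreal_mult)
qed

end
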